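(* Let $\Omega\subset\mathbb{R}^n$ be a bounded measurable set with $|\Omega|=1$ and let $a,d,\kappa_0>0$. Consider the problem $$u_t=\Big(\frac{au\xi}{1+u\xi}-d\Big)u\quad(x\in\Omega,\ t>0),\qquad \xi_t=-\xi-\xi\int_\Omega u^2\,dx+\kappa_0\quad(t>0),$$ $$u(x,0)=u_0(x),\qquad \xi(0)=\xi_0,$$ with $u_0\geq 0$ and $\xi_0>0$. If $u_0(x)\equiv\bar u_0$ is independent of $x$, then the corresponding solution is independent of $x$ as well. Thus $u(x,t)=u(t)$ and $\xi=\xi(t)$ satisfy the system of ordinary differential equations $$\frac{d}{dt}u=\Big(\frac{au\xi}{1+u\xi}-d\Big)u,\qquad \frac{d}{dt}\xi=-\xi-\xi u^2+\kappa_0,$$ which, supplemented with initial data $\bar u_0>0$ and $\xi_0>0$, has a unique global-in-time positive solution $(\bar u(t),\xi(t))$. This solution is bounded for $t>0$.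
   Context: The solution of the nonlocal problem is the unique global-in-time nonnegative solution $u\in C([0,\infty),C(\overline\Omega))$, $\xi\in C^1([0,\infty))$ with $u(x,\cdot)\in C^1([0,\infty))$ for every $x\in\Omega$. $|\Omega|$ denotes the Lebesgue measure of $\Omega$. *)

theory Defs
  imports "HOL-Analysis.Analysis"
begin

text \<open>The derivative at \<open>0\<close> is the one-sided one.\<close>

definition C1_halfline :: "(real \<Rightarrow> real) \<Rightarrow> bool" where
  "C1_halfline f \<longleftrightarrow>
     (\<exists>f'. continuous_on {0..} f' \<and>
           (\<forall>t\<ge>0. (f has_real_derivative f' t) (at t within {0..})))"

text \<open>Membership in \<open>C([0,\<infinity>), C(K))\<close> for compact \<open>K\<close>, where \<open>C(K)\<close> carries the supremum norm;
  the time variable is the first argument of \<open>u\<close>.\<close>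

definition C_halfline_into_C :: "'a::topological_space set \<Rightarrow> (real \<Rightarrow> 'a \<Rightarrow> real) \<Rightarrow> bool" where
  "C_halfline_into_C K u \<longleftrightarrow>
     (\<forall>t\<ge>0. continuous_on K (u t) \<and> uniform_limit K u (u t) (at t within {0..}))"

definition nonlocal_solution ::
  "(real ^ 'n) set \<Rightarrow> real \<Rightarrow> real \<Rightarrow> real \<Rightarrow> (real ^ 'n \<Rightarrow> real) \<Rightarrow> real \<Rightarrow>
     (real \<Rightarrow> real ^ 'n \<Rightarrow> real) \<Rightarrow> (real \<Rightarrow> real) \<Rightarrow> bool" where
  "nonlocal_solution \<Omega> a d \<kappa>\<^sub>0 u\<^sub>0 \<xi>\<^sub>0 u \<xi> \<longleftrightarrow>
     C_halfline_into_C (closure \<Omega>) u \<and>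
     (\<forall>x\<in>\<Omega>. C1_halfline (\<lambda>t. u t x)) \<and>
     C1_halfline \<xi> \<and>
     (\<forall>t\<ge>0. (\<forall>x\<in>closure \<Omega>. 0 \<le> u t x) \<and> 0 \<le> \<xi> t) \<and>
     (\<forall>x\<in>\<Omega>. \<forall>t>0.
        ((\<lambda>s. u s x) has_real_derivative
           (a * u t x * \<xi> t / (1 + u t x * \<xi> t) - d) * u t x) (at t)) \<and>
     (\<forall>t>0.
        (\<xi> has_real_derivative
           - \<xi> t - \<xi> t * (LINT x:\<Omega>|lebesgue. (u t x)\<^sup>2) + \<kappa>\<^sub>0) (at t)) \<and>
     (\<forall>x\<in>\<Omega>. u 0 x = u\<^sub>0 x) \<and>
     \<xi> 0 = \<xi>\<^sub>0"

definition ode_solution ::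
  "real \<Rightarrow> real \<Rightarrow> real \<Rightarrow> real \<Rightarrow> real \<Rightarrow> (real \<Rightarrow> real) \<Rightarrow> (real \<Rightarrow> real) \<Rightarrow> bool" where
  "ode_solution a d \<kappa>\<^sub>0 v\<^sub>0 \<xi>\<^sub>0 v \<xi> \<longleftrightarrow>
     C1_halfline v \<and> C1_halfline \<xi> \<and>
     (\<forall>t>0. (v has_real_derivative (a * v t * \<xi> t / (1 + v t * \<xi> t) - d) * v t) (at t)) \<and>
     (\<forall>t>0. (\<xi> has_real_derivative - \<xi> t - \<xi> t * (v t)\<^sup>2 + \<kappa>\<^sub>0) (at t)) \<and>
     v 0 = v\<^sub>0 \<and> \<xi> 0 = \<xi>\<^sub>0"

definition positive_ode_solution ::
  "real \<Rightarrow> real \<Rightarrow> real \<Rightarrow> real \<Rightarrow> real \<Rightarrow> (real \<Rightarrow> real) \<Rightarrow> (real \<Rightarrow> real) \<Rightarrow> bool" where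
  "positive_ode_solution a d \<kappa>\<^sub>0 v\<^sub>0 \<xi>\<^sub>0 v \<xi> \<longleftrightarrow>
     ode_solution a d \<kappa>\<^sub>0 v\<^sub>0 \<xi>\<^sub>0 v \<xi> \<and> (\<forall>t\<ge>0. 0 < v t \<and> 0 < \<xi> t)"

end

theory Submission
  imports Defs
begin

text \<open>
  The quantity \<open>v + a \<xi>\<close> satisfies \<open>(v + a \<xi>)' \<le> a \<kappa>\<^sub>0 - min d 1 (v + a \<xi>)\<close>, because
  \<open>v\<^sup>2 \<xi> / (1 + v \<xi>) \<le> v\<^sup>2 \<xi>\<close>. Nonnegative solutions therefore stay in a fixed rectangle, and
  outside it the vector field may be modified to a globally Lipschitz one, for which the Picard
  operator is a contraction in an exponentially weighted norm on the whole half-line. Gronwall's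
  inequality gives uniqueness. Applied for fixed \<open>\<xi>\<close> to \<open>u(x, t)\<close> and \<open>u(y, t)\<close>, it also
  shows that constant initial data yield a solution which does not depend on \<open>x\<close>.
\<close>

subsection \<open>Global solutions for Lipschitz vector fields\<close>

lemma integral_has_vector_derivative_halfline:
  fixes f :: "real \<Rightarrow> 'a::banach"
  assumes "continuous_on {0..} f" and "0 \<le> t"
  shows "((\<lambda>s. integral {0..s} f) has_vector_derivative f t) (at t within {0..})"
proof -
  have "((\<lambda>s. integral {0..s} f) has_vector_derivative f t) (at t within {0..t + 1})"
    using assms by (intro integral_has_vector_derivative) (auto intro: continuous_on_subset)
  moreover have "at t within {0..t + 1} = at t within {0..}"
    by (rule at_within_nhd[of _ "{..<t + 1}"]) auto
  ultimately show ?thesis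
    by simp
qed

text \<open>Integrating \<open>exp (K * s)\<close> gains a factor \<open>1 / K\<close>. This gain
  both keeps the Picard operator among bounded functions and turns the Lipschitz constant
  \<open>L\<close> into the contraction factor \<open>L / K\<close>.\<close>

lemma integral_exp_weighted_bound:
  fixes f :: "real \<Rightarrow> 'a::banach"
  assumes "continuous_on {0..} f" and "0 < K" and "0 \<le> t" and "0 \<le> C"
    and bound: "\<And>s. 0 \<le> s \<Longrightarrow> norm (f s) \<le> C * exp (K * s)"
  shows "exp (- (K * t)) * norm (integral {0..t} f) \<le> C / K"
proof -
  have int: "((\<lambda>s. C * exp (K * s)) has_integral (C / K * exp (K * t) - C / K * exp (K * 0))) {0..t}"
    using \<open>0 \<le> t\<close> \<open>0 < K\<close>
    by (intro fundamental_theorem_of_calculus)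
       (auto intro!: derivative_eq_intros simp: has_real_derivative_iff_has_vector_derivative[symmetric])
  have "norm (integral {0..t} f) \<le> integral {0..t} (\<lambda>s. C * exp (K * s))"
  proof (rule integral_norm_bound_integral)
    show "f integrable_on {0..t}"
      by (intro integrable_continuous_real continuous_on_subset[OF assms(1)]) auto
  qed (use bound int in auto)
  also have "\<dots> = C / K * exp (K * t) - C / K"
    using integral_unique[OF int] by (simp only: mult_zero_right exp_zero mult_1_right)
  also have "\<dots> \<le> C / K * exp (K * t)"
    using assms by simp
  finally have "exp (- (K * t)) * norm (integral {0..t} f) \<le> exp (- (K * t)) * (C / K * exp (K * t))"
    by (intro mult_left_mono) auto
  also have "\<dots> = C / K"
    by (simp add: exp_minus)
  finally show ?thesis .
qed

text \<open>Working at once on the whole half-line avoids gluing or extending local solutions. The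
  type of bounded continuous functions has all of \<open>real\<close> as domain, so the operator
  freezes time at 0 for negative arguments through \<open>max 0 t\<close>.\<close>

theorem global_Picard_Lindelof:
  fixes F :: "'a::banach \<Rightarrow> 'a"
  assumes lip: "L-lipschitz_on UNIV F"
  obtains z where "z 0 = z\<^sub>0"
    and "\<And>t. 0 \<le> t \<Longrightarrow> (z has_vector_derivative F (z t)) (at t within {0..})"
proof -
  \<comment> \<open>Any \<open>K > L\<close> would do: it gives \<open>L / K < 1\<close>, and
    \<open>K\<close> stays positive even if \<open>L = 0\<close>.\<close>
  define K where "K = L + 1"
  have L: "0 \<le> L"
    using lip by (rule lipschitz_on_nonneg)
  hence K: "0 < K"
    by (simp add: K_def)
  have dF: "norm (F x - F y) \<le> L * norm (x - y)" for x y
    using lipschitz_onD[OF lip] by (simp add: dist_norm)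
  define H where "H y s = F (exp (K * s) *\<^sub>R apply_bcontfun y s)" for y :: "real \<Rightarrow>\<^sub>C 'a" and s
  \<comment> \<open>The Picard operator for \<open>y t = exp (- K t) z t\<close>; this weight makes it a contraction on the
    whole half-line.\<close>
  define P where "P y t = exp (- (K * max 0 t)) *\<^sub>R (z\<^sub>0 + integral {0..max 0 t} (H y))"
    for y and t :: real
  have contF: "continuous_on S F" for S
    using lipschitz_on_continuous_on[OF lip] continuous_on_subset by blast
  have contH: "continuous_on S (H y)" for S y
    unfolding H_def
    by (rule continuous_on_compose2[OF contF[of UNIV]]) (auto intro!: continuous_intros)
  have contI: "continuous_on {0..} (\<lambda>t. integral {0..t} (H y))" for y
    using integral_has_vector_derivative_halfline[OF contH] has_vector_derivative_continuous
    by (fastforce simp: continuous_on_eq_continuous_within)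
  have contP: "continuous_on UNIV (P y)" for y
    unfolding P_def
    by (intro continuous_intros continuous_on_compose2[OF contI]) auto
  \<comment> \<open>A Lipschitz \<open>F\<close> grows at most linearly, so for bounded
    \<open>y\<close> the integrand \<open>H y s\<close> is of order \<open>exp (K * s)\<close>,
    exactly the growth that the weight absorbs.\<close>
  have bcP: "P y \<in> bcontfun" for y
  proof -
    obtain Y where Y: "\<And>s. norm (apply_bcontfun y s) \<le> Y"
      using bounded_apply_bcontfun[of y] by (auto simp: bounded_iff)
    have Y0: "0 \<le> Y"
      using Y[of 0] norm_ge_zero order_trans by blast
    have Hb: "norm (H y s) \<le> (norm (F 0) + L * Y) * exp (K * s)" if "0 \<le> s" for s
    proof -
      have "norm (H y s) \<le> norm (F 0) + norm (F (exp (K * s) *\<^sub>R y s) - F 0)"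
        unfolding H_def by norm
      also have "\<dots> \<le> norm (F 0) * exp (K * s) + L * (exp (K * s) * Y)"
      proof (rule add_mono)
        show "norm (F 0) \<le> norm (F 0) * exp (K * s)"
          using K that by (simp add: mult_le_cancel_left1)
        show "norm (F (exp (K * s) *\<^sub>R y s) - F 0) \<le> L * (exp (K * s) * Y)"
          using dF[of "exp (K * s) *\<^sub>R y s" 0] L Y[of s]
          by (elim order_trans) (auto intro!: mult_left_mono)
      qed
      finally show ?thesis
        by (simp add: algebra_simps)
    qed
    have "norm (P y t) \<le> norm z\<^sub>0 + (norm (F 0) + L * Y) / K" for t
    proof -
      let ?t = "max 0 t"
      have "norm (P y t) \<le> exp (- (K * ?t)) * (norm z\<^sub>0 + norm (integral {0..?t} (H y)))"
        unfolding P_def by (auto intro!: mult_left_mono norm_triangle_ineq)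
      also have "\<dots> = exp (- (K * ?t)) * norm z\<^sub>0 + exp (- (K * ?t)) * norm (integral {0..?t} (H y))"
        by (simp add: algebra_simps)
      also have "\<dots> \<le> norm z\<^sub>0 + (norm (F 0) + L * Y) / K"
        using K L Y0 Hb
        by (intro add_mono integral_exp_weighted_bound[OF contH] mult_left_le_one_le) auto
      finally show ?thesis .
    qed
    thus ?thesis
      using contP by (auto simp: bcontfun_def bounded_iff)
  qed
  have P_app: "apply_bcontfun (Bcontfun (P y)) = P y" for y
    using bcP by (rule Bcontfun_inverse)
  have contraction: "dist (Bcontfun (P x)) (Bcontfun (P y)) \<le> L / K * dist x y" for x y
  proof (rule dist_bound)
    fix t :: real
    let ?t = "max 0 t"
    have Hb: "norm (H x s - H y s) \<le> (L * dist x y) * exp (K * s)" if "0 \<le> s" for s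
    proof -
      have "norm (H x s - H y s) \<le> L * norm (exp (K * s) *\<^sub>R x s - exp (K * s) *\<^sub>R y s)"
        unfolding H_def by (rule dF)
      also have "\<dots> = L * (exp (K * s) * dist (x s) (y s))"
        by (simp add: dist_norm scaleR_diff_right[symmetric])
      also have "\<dots> \<le> L * (exp (K * s) * dist x y)"
        using L by (intro mult_left_mono dist_bounded) auto
      finally show ?thesis
        by (simp add: algebra_simps)
    qed
    have "P x t - P y t = exp (- (K * ?t)) *\<^sub>R (integral {0..?t} (H x) - integral {0..?t} (H y))"
      by (simp add: P_def scaleR_diff_right[symmetric])
    also have "integral {0..?t} (H x) - integral {0..?t} (H y) = integral {0..?t} (\<lambda>s. H x s - H y s)"
      by (intro integral_diff[symmetric] integrable_continuous_real contH)
    finally have "dist (P x t) (P y t) = exp (- (K * ?t)) * norm (integral {0..?t} (\<lambda>s. H x s - H y s))"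
      by (simp add: dist_norm)
    also have "\<dots> \<le> L * dist x y / K"
      using K L Hb by (intro integral_exp_weighted_bound continuous_intros contH) auto
    finally show "dist (apply_bcontfun (Bcontfun (P x)) t) (apply_bcontfun (Bcontfun (P y)) t)
        \<le> L / K * dist x y"
      by (simp add: P_app)
  qed
  have "\<exists>!y. Bcontfun (P y) = y"
    using contraction L K by (intro banach_fix_type[of "L / K"]) (auto simp: K_def)
  then obtain y where "Bcontfun (P y) = y"
    by blast
  hence y: "apply_bcontfun y = P y"
    by (metis P_app)
  \<comment> \<open>As an integral, \<open>z\<close> is differentiable with derivative
    \<open>H y t\<close>. The fixed point equation identifies it with \<open>exp (K * t)\<close>
    times \<open>y t\<close>, and this turns \<open>H y t\<close> into
    \<open>F (z t)\<close>.\<close>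
  define z where "z t = z\<^sub>0 + integral {0..t} (H y)" for t
  have z: "z t = exp (K * t) *\<^sub>R apply_bcontfun y t" if "0 \<le> t" for t
    using that by (simp add: y P_def z_def exp_minus max_def)
  have "(z has_vector_derivative F (z t)) (at t within {0..})" if "0 \<le> t" for t
  proof -
    have "(z has_vector_derivative H y t) (at t within {0..})"
      unfolding z_def
      by (auto intro!: derivative_eq_intros integral_has_vector_derivative_halfline[OF contH that])
    thus ?thesis
      using z[OF that] by (simp add: H_def)
  qed
  moreover have "z 0 = z\<^sub>0"
    by (simp add: z_def)
  ultimately show thesis
    by (rule that[rotated])
qed

subsection \<open>Differential inequalities\<close>

text \<open>If \<open>f t > b\<close>, take the last time \<open>s\<close> in \<open>{0..t}\<close>
  with \<open>f s \<le> b\<close>. After \<open>s\<close> the function lies above \<open>b\<close>,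
  hence is nonincreasing there, so \<open>f t \<le> f s \<le> b\<close>. The sign of the derivative
  matters only above the barrier.\<close>

lemma le_barrier:
  fixes f f' :: "real \<Rightarrow> real"
  assumes cont: "continuous_on {0..} f"
    and deriv: "\<And>t. 0 < t \<Longrightarrow> (f has_real_derivative f' t) (at t)"
    and inward: "\<And>t. 0 < t \<Longrightarrow> b < f t \<Longrightarrow> f' t \<le> 0"
    and "f 0 \<le> b" and "0 \<le> t"
  shows "f t \<le> b"
proof (rule ccontr)
  assume "\<not> f t \<le> b"
  define S where "S = {s \<in> {0..t}. f s \<le> b}"
  have contt: "continuous_on {0..t} f"
    using cont by (rule continuous_on_subset) auto
  have "closed S"
    unfolding S_def by (intro continuous_on_closed_Collect_le contt continuous_intros closed_atLeastAtMost)
  moreover have "0 \<in> S" and bdd: "bdd_above S"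
    using assms by (auto simp: S_def)
  ultimately have "Sup S \<in> S"
    by (intro closed_contains_Sup) auto
  hence s: "0 \<le> Sup S" "Sup S \<le> t" "f (Sup S) \<le> b"
    by (auto simp: S_def)
  have above: "b < f r" if "Sup S < r" "r \<le> t" for r
    using cSup_upper[OF _ bdd, of r] that s by (force simp: S_def)
  have "f t \<le> f (Sup S)"
  proof (rule DERIV_nonpos_imp_decreasing_open[where a = "Sup S" and b = t and f = f])
    fix r assume "Sup S < r" "r < t"
    thus "\<exists>y. (f has_real_derivative y) (at r) \<and> y \<le> 0"
      using deriv[of r] inward[of r] above[of r] s by force
  qed (use s contt in \<open>auto intro: continuous_on_subset\<close>)
  thus False
    using s \<open>\<not> f t \<le> b\<close> by linarith
qed

text \<open>The integrating factor \<open>exp (C * t)\<close> makes the product with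
  \<open>f\<close> nondecreasing, so it stays above its positive initial value.\<close>

lemma positive_if_deriv_ge_linear:
  fixes f f' :: "real \<Rightarrow> real"
  assumes cont: "continuous_on {0..} f"
    and deriv: "\<And>t. 0 < t \<Longrightarrow> (f has_real_derivative f' t) (at t)"
    and ge: "\<And>t. 0 < t \<Longrightarrow> - C * f t \<le> f' t"
    and "0 < f 0" and "0 \<le> t"
  shows "0 < f t"
proof -
  have "exp (C * 0) * f 0 \<le> exp (C * t) * f t"
  proof (rule DERIV_nonneg_imp_increasing_open[OF \<open>0 \<le> t\<close>])
    fix r assume r: "0 < r" "r < t"
    have "((\<lambda>s. exp (C * s) * f s) has_real_derivative exp (C * r) * (f' r + C * f r)) (at r)"
      using deriv[OF r(1)] by (auto intro!: derivative_eq_intros simp: algebra_simps)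
    moreover have "0 \<le> exp (C * r) * (f' r + C * f r)"
      using ge[OF r(1)] by (intro mult_nonneg_nonneg) auto
    ultimately show "\<exists>y. ((\<lambda>s. exp (C * s) * f s) has_real_derivative y) (at r) \<and> 0 \<le> y"
      by blast
  next
    show "continuous_on {0..t} (\<lambda>s. exp (C * s) * f s)"
      by (intro continuous_intros continuous_on_subset[OF cont]) auto
  qed
  hence "0 < exp (C * t) * f t"
    using \<open>0 < f 0\<close> by simp
  thus ?thesis
    by (simp add: zero_less_mult_iff)
qed

text \<open>Squares avoid differentiating absolute values: the derivative of
  \<open>e\<^sub>1\<^sup>2 + e\<^sub>2\<^sup>2\<close> is at most \<open>2 * L *
  (\<bar>e\<^sub>1\<bar> + \<bar>e\<^sub>2\<bar>)\<^sup>2\<close>, hence at most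
  \<open>4 * L\<close> times the sum of squares. Weighted by \<open>exp (- (4 * L * t))\<close>,
  that sum is nonincreasing, nonnegative and initially zero.\<close>

lemma Gronwall_pair_zero:
  fixes e\<^sub>1 e\<^sub>2 e\<^sub>1' e\<^sub>2' :: "real \<Rightarrow> real"
  assumes cont: "continuous_on {0..T} e\<^sub>1" "continuous_on {0..T} e\<^sub>2"
    and deriv: "\<And>t. 0 < t \<Longrightarrow> t < T \<Longrightarrow> (e\<^sub>1 has_real_derivative e\<^sub>1' t) (at t)"
      "\<And>t. 0 < t \<Longrightarrow> t < T \<Longrightarrow> (e\<^sub>2 has_real_derivative e\<^sub>2' t) (at t)"
    and bound: "\<And>t. 0 < t \<Longrightarrow> t < T \<Longrightarrow> \<bar>e\<^sub>1' t\<bar> \<le> L * (\<bar>e\<^sub>1 t\<bar> + \<bar>e\<^sub>2 t\<bar>)"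
      "\<And>t. 0 < t \<Longrightarrow> t < T \<Longrightarrow> \<bar>e\<^sub>2' t\<bar> \<le> L * (\<bar>e\<^sub>1 t\<bar> + \<bar>e\<^sub>2 t\<bar>)"
    and "e\<^sub>1 0 = 0" "e\<^sub>2 0 = 0" and "0 \<le> T" and "0 \<le> L"
  shows "e\<^sub>1 T = 0 \<and> e\<^sub>2 T = 0"
proof -
  define g where "g t = exp (- (4 * L * t)) * ((e\<^sub>1 t)\<^sup>2 + (e\<^sub>2 t)\<^sup>2)" for t
  have "g T \<le> g 0"
  proof (rule DERIV_nonpos_imp_decreasing_open[OF \<open>0 \<le> T\<close>])
    fix t assume t: "0 < t" "t < T"
    define y where "y = exp (- (4 * L * t)) *
      (2 * e\<^sub>1 t * e\<^sub>1' t + 2 * e\<^sub>2 t * e\<^sub>2' t - 4 * L * ((e\<^sub>1 t)\<^sup>2 + (e\<^sub>2 t)\<^sup>2))"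
    have "(g has_real_derivative y) (at t)"
      unfolding g_def y_def using deriv[OF t]
      by (auto intro!: derivative_eq_intros simp: algebra_simps power2_eq_square)
    moreover have "y \<le> 0"
    proof -
      have "e\<^sub>1 t * e\<^sub>1' t \<le> \<bar>e\<^sub>1 t\<bar> * (L * (\<bar>e\<^sub>1 t\<bar> + \<bar>e\<^sub>2 t\<bar>))"
        using mult_left_mono[OF bound(1)[OF t], of "\<bar>e\<^sub>1 t\<bar>"] abs_ge_self[of "e\<^sub>1 t * e\<^sub>1' t"]
        by (simp add: abs_mult)
      moreover have "e\<^sub>2 t * e\<^sub>2' t \<le> \<bar>e\<^sub>2 t\<bar> * (L * (\<bar>e\<^sub>1 t\<bar> + \<bar>e\<^sub>2 t\<bar>))"
        using mult_left_mono[OF bound(2)[OF t], of "\<bar>e\<^sub>2 t\<bar>"] abs_ge_self[of "e\<^sub>2 t * e\<^sub>2' t"]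
        by (simp add: abs_mult)
      ultimately have "e\<^sub>1 t * e\<^sub>1' t + e\<^sub>2 t * e\<^sub>2' t \<le> L * (\<bar>e\<^sub>1 t\<bar> + \<bar>e\<^sub>2 t\<bar>)\<^sup>2"
        by (simp add: algebra_simps power2_eq_square)
      also have "\<dots> \<le> L * (2 * ((e\<^sub>1 t)\<^sup>2 + (e\<^sub>2 t)\<^sup>2))"
        using sum_squares_bound[of "\<bar>e\<^sub>1 t\<bar>" "\<bar>e\<^sub>2 t\<bar>"] \<open>0 \<le> L\<close>
        by (intro mult_left_mono) (auto simp: power2_sum)
      finally show ?thesis
        unfolding y_def by (intro mult_nonneg_nonpos) (auto simp: algebra_simps)
    qed
    ultimately show "\<exists>y. (g has_real_derivative y) (at t) \<and> y \<le> 0"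
      by blast
  next
    show "continuous_on {0..T} g"
      unfolding g_def by (intro continuous_intros cont)
  qed
  hence "exp (- (4 * L * T)) * ((e\<^sub>1 T)\<^sup>2 + (e\<^sub>2 T)\<^sup>2) \<le> 0"
    using assms by (simp add: g_def)
  hence "(e\<^sub>1 T)\<^sup>2 + (e\<^sub>2 T)\<^sup>2 \<le> 0"
    by (simp add: mult_le_0_iff)
  thus ?thesis
    by (simp add: sum_power2_le_zero_iff)
qed

subsection \<open>The vector field\<close>

definition u_rate :: "real \<Rightarrow> real \<Rightarrow> real \<Rightarrow> real \<Rightarrow> real" where
  "u_rate a d p q = (a * p * q / (1 + p * q) - d) * p"

definition \<xi>_rate :: "real \<Rightarrow> real \<Rightarrow> real \<Rightarrow> real" where
  "\<xi>_rate \<kappa>\<^sub>0 p q = - q - q * p\<^sup>2 + \<kappa>\<^sub>0"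

text \<open>Both rates contain the term \<open>p\<^sup>2 * q\<close>: one as the numerator of the
  growth term, the other as absorption. Changing one variable at a time splits the difference into
  two products with factors bounded on the square.\<close>

lemma square_times_Lipschitz:
  fixes p q p' q' R :: real
  assumes "p \<in> {0..R}" "q \<in> {0..R}" "p' \<in> {0..R}" "q' \<in> {0..R}"
  shows "\<bar>p\<^sup>2 * q - p'\<^sup>2 * q'\<bar> \<le> 2 * R\<^sup>2 * (\<bar>p - p'\<bar> + \<bar>q - q'\<bar>)"
proof -
  have "p\<^sup>2 * q - p'\<^sup>2 * q' = (p - p') * ((p + p') * q) + (q - q') * p'\<^sup>2"
    by (simp add: algebra_simps power2_eq_square)
  hence "\<bar>p\<^sup>2 * q - p'\<^sup>2 * q'\<bar> \<le> \<bar>p - p'\<bar> * ((p + p') * q) + \<bar>q - q'\<bar> * p'\<^sup>2"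
    using assms abs_triangle_ineq[of "(p - p') * ((p + p') * q)" "(q - q') * p'\<^sup>2"]
    by (simp add: abs_mult)
  also have "\<dots> \<le> \<bar>p - p'\<bar> * (2 * R\<^sup>2) + \<bar>q - q'\<bar> * (2 * R\<^sup>2)"
  proof (intro add_mono mult_left_mono)
    have "(p + p') * q \<le> (R + R) * R"
      using assms by (intro mult_mono) auto
    thus "(p + p') * q \<le> 2 * R\<^sup>2"
      by (simp add: power2_eq_square)
    have "p'\<^sup>2 \<le> R\<^sup>2"
      using assms by (intro power_mono) auto
    thus "p'\<^sup>2 \<le> 2 * R\<^sup>2"
      using zero_le_power2[of R] by linarith
  qed auto
  finally show ?thesis
    by (simp add: algebra_simps)
qed

text \<open>Over a common denominator the growth terms differ by a polynomial divided by
  \<open>den \<ge> 1\<close>, so only the numerator has to be estimated.\<close>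

lemma u_rate_Lipschitz:
  assumes "p \<in> {0..R}" "q \<in> {0..R}" "p' \<in> {0..R}" "q' \<in> {0..R}" and "0 < a" "0 < d"
  shows "\<bar>u_rate a d p q - u_rate a d p' q'\<bar>
    \<le> (a * (2 * R\<^sup>2 + R ^ 4) + d) * (\<bar>p - p'\<bar> + \<bar>q - q'\<bar>)"
proof -
  let ?D = "\<bar>p - p'\<bar> + \<bar>q - q'\<bar>"
  \<comment> \<open>This is \<open>p\<^sup>2 * q * (1 + p' * q') - p'\<^sup>2 * q' * (1 + p *
    q)\<close>, with the fifth-degree part factored; that part contributes the \<open>R ^ 4\<close>
    to the constant.\<close>
  define N where "N = p\<^sup>2 * q - p'\<^sup>2 * q' + p * p' * q * q' * (p - p')"
  define den where "den = (1 + p * q) * (1 + p' * q')"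
  have pos: "1 \<le> 1 + p * q" "1 \<le> 1 + p' * q'"
    using assms by auto
  hence den: "1 \<le> den"
    unfolding den_def using mult_mono[of 1 "1 + p * q" 1 "1 + p' * q'"] by simp
  have ur: "u_rate a d x y = a * (x\<^sup>2 * y / (1 + x * y)) - d * x" for x y
    by (simp add: u_rate_def algebra_simps power2_eq_square)
  have "p\<^sup>2 * q / (1 + p * q) - p'\<^sup>2 * q' / (1 + p' * q') = N / den"
    using pos by (subst diff_frac_eq) (auto simp: N_def den_def algebra_simps power2_eq_square)
  hence eq: "u_rate a d p q - u_rate a d p' q' = a * (N / den) - d * (p - p')"
    unfolding ur by (simp add: algebra_simps)
  have "p * p' * q * q' \<le> R * R * R * R"
    using assms by (intro mult_mono) auto
  hence "p * p' * q * q' \<le> R ^ 4"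
    by (simp add: power4_eq_xxxx)
  hence "\<bar>p * p' * q * q' * (p - p')\<bar> \<le> R ^ 4 * \<bar>p - p'\<bar>"
    using assms by (auto simp: abs_mult intro!: mult_right_mono)
  also have "\<dots> \<le> R ^ 4 * ?D"
    by (intro mult_left_mono) auto
  finally have N: "\<bar>N\<bar> \<le> (2 * R\<^sup>2 + R ^ 4) * ?D"
    using square_times_Lipschitz[OF assms(1-4)] unfolding N_def distrib_right[of _ _ "?D"] by linarith
  have "\<bar>N / den\<bar> \<le> \<bar>N\<bar>"
    using den by (simp add: abs_divide divide_le_eq mult_le_cancel_left1)
  hence "\<bar>a * (N / den)\<bar> \<le> a * ((2 * R\<^sup>2 + R ^ 4) * ?D)"
    unfolding abs_mult[of a] abs_of_pos[OF \<open>0 < a\<close>]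
    using N \<open>0 < a\<close> by (intro mult_left_mono) linarith+
  moreover have "\<bar>d * (p - p')\<bar> \<le> d * ?D"
    using \<open>0 < d\<close> by (simp add: abs_mult)
  moreover have "\<bar>a * (N / den) - d * (p - p')\<bar> \<le> \<bar>a * (N / den)\<bar> + \<bar>d * (p - p')\<bar>"
    by (rule abs_triangle_ineq4)
  ultimately have "\<bar>u_rate a d p q - u_rate a d p' q'\<bar> \<le> a * ((2 * R\<^sup>2 + R ^ 4) * ?D) + d * ?D"
    unfolding eq by linarith
  also have "\<dots> = (a * (2 * R\<^sup>2 + R ^ 4) + d) * ?D"
    by (simp add: algebra_simps)
  finally show ?thesis .
qed

lemma \<xi>_rate_Lipschitz:
  assumes "p \<in> {0..R}" "q \<in> {0..R}" "p' \<in> {0..R}" "q' \<in> {0..R}"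
  shows "\<bar>\<xi>_rate \<kappa>\<^sub>0 p q - \<xi>_rate \<kappa>\<^sub>0 p' q'\<bar> \<le> (1 + 2 * R\<^sup>2) * (\<bar>p - p'\<bar> + \<bar>q - q'\<bar>)"
proof -
  have "\<xi>_rate \<kappa>\<^sub>0 p q - \<xi>_rate \<kappa>\<^sub>0 p' q' = (q' - q) - (p\<^sup>2 * q - p'\<^sup>2 * q')"
    by (simp add: \<xi>_rate_def algebra_simps)
  thus ?thesis
    using square_times_Lipschitz[OF assms] by (simp add: distrib_right)
qed

lemma rates_Lipschitz:
  assumes "0 < a" "0 < d"
  obtains L where "0 \<le> L"
    and "\<And>p q p' q'. p \<in> {0..R} \<Longrightarrow> q \<in> {0..R} \<Longrightarrow> p' \<in> {0..R} \<Longrightarrow> q' \<in> {0..R} \<Longrightarrow>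
      \<bar>u_rate a d p q - u_rate a d p' q'\<bar> \<le> L * (\<bar>p - p'\<bar> + \<bar>q - q'\<bar>) \<and>
      \<bar>\<xi>_rate \<kappa>\<^sub>0 p q - \<xi>_rate \<kappa>\<^sub>0 p' q'\<bar> \<le> L * (\<bar>p - p'\<bar> + \<bar>q - q'\<bar>)"
proof
  let ?L = "max (a * (2 * R\<^sup>2 + R ^ 4) + d) (1 + 2 * R\<^sup>2)"
  show "0 \<le> ?L"
    by (simp add: le_max_iff_disj)
  fix p q p' q' assume R: "p \<in> {0..R}" "q \<in> {0..R}" "p' \<in> {0..R}" "q' \<in> {0..R}"
  show "\<bar>u_rate a d p q - u_rate a d p' q'\<bar> \<le> ?L * (\<bar>p - p'\<bar> + \<bar>q - q'\<bar>) \<and>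
      \<bar>\<xi>_rate \<kappa>\<^sub>0 p q - \<xi>_rate \<kappa>\<^sub>0 p' q'\<bar> \<le> ?L * (\<bar>p - p'\<bar> + \<bar>q - q'\<bar>)"
    using u_rate_Lipschitz[OF R assms] \<xi>_rate_Lipschitz[OF R, of \<kappa>\<^sub>0]
    by (auto elim!: order_trans intro!: mult_right_mono)
qed

lemma C1_halfline_imp_continuous_on:
  assumes "C1_halfline f"
  shows "continuous_on {0..} f"
proof -
  obtain f' where "\<forall>t\<ge>0. (f has_real_derivative f' t) (at t within {0..})"
    using assms unfolding C1_halfline_def by blast
  thus ?thesis
    by (auto intro!: DERIV_continuous_on[of _ _ f'])
qed

lemma ode_solution_iff_rates:
  "ode_solution a d \<kappa>\<^sub>0 v\<^sub>0 \<xi>\<^sub>0 v \<xi> \<longleftrightarrow>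
     C1_halfline v \<and> C1_halfline \<xi> \<and>
     (\<forall>t>0. (v has_real_derivative u_rate a d (v t) (\<xi> t)) (at t)) \<and>
     (\<forall>t>0. (\<xi> has_real_derivative \<xi>_rate \<kappa>\<^sub>0 (v t) (\<xi> t)) (at t)) \<and>
     v 0 = v\<^sub>0 \<and> \<xi> 0 = \<xi>\<^sub>0"
  by (simp add: ode_solution_def u_rate_def \<xi>_rate_def)

text \<open>The growth of \<open>u\<close> is at most \<open>a * p\<^sup>2 * q\<close>, which the
  absorption in \<open>a * \<xi>\<close> cancels. Stating this for arbitrary nonnegative
  \<open>p\<close>, \<open>q\<close> instead of along a solution allows truncated values to be
  inserted.\<close>

lemma mass_rate_le:
  assumes "0 < a" and "0 \<le> p" "0 \<le> q"
  shows "u_rate a d p q + a * \<xi>_rate \<kappa>\<^sub>0 p q \<le> a * \<kappa>\<^sub>0 - (d * p + a * q)"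
proof -
  have "p\<^sup>2 * q / (1 + p * q) \<le> p\<^sup>2 * q / 1"
    using assms by (intro divide_left_mono) (auto intro: add_pos_nonneg)
  hence "a * (p\<^sup>2 * q / (1 + p * q)) \<le> a * (p\<^sup>2 * q)"
    using \<open>0 < a\<close> by (intro mult_left_mono) auto
  thus ?thesis
    by (simp add: u_rate_def \<xi>_rate_def algebra_simps power2_eq_square)
qed

subsection \<open>Existence, boundedness and positivity\<close>

text \<open>Clamping to an interval does not increase distances, so composing the rates with it
  gives a field that is Lipschitz on the whole plane, to which the global existence theorem
  applies.\<close>

lemma truncated_ode_solution_exists:
  fixes a d \<kappa>\<^sub>0 M N v\<^sub>0 \<xi>\<^sub>0 :: real
  assumes "0 < a" "0 < d" "0 \<le> M" "0 \<le> N"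
  obtains v \<xi> where "C1_halfline v" "C1_halfline \<xi>" "v 0 = v\<^sub>0" "\<xi> 0 = \<xi>\<^sub>0"
    and "\<And>t. 0 < t \<Longrightarrow>
      (v has_real_derivative u_rate a d (max 0 (min M (v t))) (max 0 (min N (\<xi> t)))) (at t)"
    and "\<And>t. 0 < t \<Longrightarrow>
      (\<xi> has_real_derivative \<xi>_rate \<kappa>\<^sub>0 (max 0 (min M (v t))) (max 0 (min N (\<xi> t)))) (at t)"
proof -
  define P where "P x = max 0 (min M x)" for x
  define Q where "Q x = max 0 (min N x)" for x
  define R where "R = max M N"
  obtain L where L: "0 \<le> L"
    "\<And>p q p' q'. p \<in> {0..R} \<Longrightarrow> q \<in> {0..R} \<Longrightarrow> p' \<in> {0..R} \<Longrightarrow> q' \<in> {0..R} \<Longrightarrow>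
      \<bar>u_rate a d p q - u_rate a d p' q'\<bar> \<le> L * (\<bar>p - p'\<bar> + \<bar>q - q'\<bar>) \<and>
      \<bar>\<xi>_rate \<kappa>\<^sub>0 p q - \<xi>_rate \<kappa>\<^sub>0 p' q'\<bar> \<le> L * (\<bar>p - p'\<bar> + \<bar>q - q'\<bar>)"
    using rates_Lipschitz[OF assms(1,2)] by metis
  have PQ: "P x \<in> {0..R}" "Q x \<in> {0..R}" for x
    using assms by (auto simp: P_def Q_def R_def)
  have dPQ: "\<bar>P x - P y\<bar> \<le> \<bar>x - y\<bar>" "\<bar>Q x - Q y\<bar> \<le> \<bar>x - y\<bar>" for x y
    by (auto simp: P_def Q_def)
  define F where "F z = (u_rate a d (P (fst z)) (Q (snd z)), \<xi>_rate \<kappa>\<^sub>0 (P (fst z)) (Q (snd z)))" for z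
  \<comment> \<open>One factor 2 comes from adding the two components of \<open>F\<close>, the other
    from bounding each of the two coordinate differences by \<open>dist z w\<close>.\<close>
  have lip: "(4 * L)-lipschitz_on UNIV F"
  proof (rule lipschitz_onI)
    fix z w :: "real \<times> real"
    let ?D = "\<bar>P (fst z) - P (fst w)\<bar> + \<bar>Q (snd z) - Q (snd w)\<bar>"
    have "\<bar>fst z - fst w\<bar> \<le> dist z w" "\<bar>snd z - snd w\<bar> \<le> dist z w"
      using dist_fst_le[of z w] dist_snd_le[of z w] by (auto simp: dist_real_def)
    hence D: "?D \<le> 2 * dist z w"
      using dPQ(1)[of "fst z" "fst w"] dPQ(2)[of "snd z" "snd w"] by linarith
    have "dist (F z) (F w) \<le> \<bar>fst (F z) - fst (F w)\<bar> + \<bar>snd (F z) - snd (F w)\<bar>"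
      using norm_Pair_le[of "fst (F z) - fst (F w)" "snd (F z) - snd (F w)"]
      by (simp add: dist_norm minus_prod_def)
    also have "\<dots> \<le> L * ?D + L * ?D"
      unfolding F_def fst_conv snd_conv using L(2) PQ by (intro add_mono) blast+
    also have "\<dots> \<le> 4 * L * dist z w"
      using mult_left_mono[OF D L(1)] by simp
    finally show "dist (F z) (F w) \<le> 4 * L * dist z w" .
  qed (use L in simp)
  obtain z where z: "z 0 = (v\<^sub>0, \<xi>\<^sub>0)"
    "\<And>t. 0 \<le> t \<Longrightarrow> (z has_vector_derivative F (z t)) (at t within {0..})"
    using global_Picard_Lindelof[OF lip] by metis
  have "continuous_on {0..} z"
    using z(2) has_vector_derivative_continuous
    by (fastforce simp: continuous_on_eq_continuous_within)
  hence "continuous_on {0..} (\<lambda>t. F (z t))"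
    by (rule continuous_on_compose2[OF lipschitz_on_continuous_on[OF lip]]) auto
  hence contF: "continuous_on {0..} (\<lambda>t. fst (F (z t)))" "continuous_on {0..} (\<lambda>t. snd (F (z t)))"
    by (auto intro: continuous_intros)
  have within: "((\<lambda>t. fst (z t)) has_real_derivative fst (F (z t))) (at t within {0..})"
    "((\<lambda>t. snd (z t)) has_real_derivative snd (F (z t))) (at t within {0..})" if "0 \<le> t" for t
    using bounded_linear.has_vector_derivative[OF bounded_linear_fst z(2)[OF that]]
      bounded_linear.has_vector_derivative[OF bounded_linear_snd z(2)[OF that]]
    by (simp_all add: has_real_derivative_iff_has_vector_derivative)
  show thesis
  proof (rule that[of "\<lambda>t. fst (z t)" "\<lambda>t. snd (z t)"])
    show "C1_halfline (\<lambda>t. fst (z t))" "C1_halfline (\<lambda>t. snd (z t))"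
      using contF within unfolding C1_halfline_def by blast+
    show "fst (z 0) = v\<^sub>0" "snd (z 0) = \<xi>\<^sub>0"
      by (simp_all add: z)
    fix t :: real assume "0 < t"
    \<comment> \<open>Positive times are interior to the half-line, so the one-sided derivative
      becomes two-sided.\<close>
    hence "at t within {0..} = at t"
      by (intro at_within_interior) (auto simp: interior_real_atLeast)
    thus "((\<lambda>t. fst (z t)) has_real_derivative
        u_rate a d (max 0 (min M (fst (z t)))) (max 0 (min N (snd (z t))))) (at t)"
      "((\<lambda>t. snd (z t)) has_real_derivative
        \<xi>_rate \<kappa>\<^sub>0 (max 0 (min M (fst (z t)))) (max 0 (min N (snd (z t))))) (at t)"
      using within[of t] \<open>0 < t\<close> by (simp_all add: F_def P_def Q_def)
  qed
qed

text \<open>Three barriers for the truncated system, at \<open>v = 0\<close>, at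
  \<open>\<xi> = 0\<close> and at \<open>v + a * \<xi> = b\<close>, confine its solution to the
  region where truncation changes nothing. It therefore solves the original system.\<close>

theorem bounded_ode_solution_exists:
  fixes a d \<kappa>\<^sub>0 v\<^sub>0 \<xi>\<^sub>0 :: real
  assumes pos: "0 < a" "0 < d" "0 < \<kappa>\<^sub>0" and "0 \<le> v\<^sub>0" "0 < \<xi>\<^sub>0"
  obtains v \<xi> b where "ode_solution a d \<kappa>\<^sub>0 v\<^sub>0 \<xi>\<^sub>0 v \<xi>"
    and "\<And>t. 0 \<le> t \<Longrightarrow> 0 \<le> v t \<and> v t \<le> b \<and> 0 \<le> \<xi> t \<and> \<xi> t \<le> b"
proof -
  define m where "m = min d 1"
  \<comment> \<open>The first entry puts the initial mass below the barrier. The second gives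
    \<open>a * \<kappa>\<^sub>0 \<le> m * b\<close>, which makes the mass nonincreasing above
    it.\<close>
  define b where "b = max (v\<^sub>0 + a * \<xi>\<^sub>0) (a * \<kappa>\<^sub>0 / m)"
  have m: "0 < m" "m \<le> d" "m \<le> 1"
    using pos by (auto simp: m_def)
  have b: "0 < b" "v\<^sub>0 + a * \<xi>\<^sub>0 \<le> b" "a * \<kappa>\<^sub>0 \<le> m * b"
  proof -
    have "0 < a * \<kappa>\<^sub>0 / m"
      using pos m by simp
    thus "0 < b"
      unfolding b_def by linarith
    have "a * \<kappa>\<^sub>0 / m \<le> b"
      unfolding b_def by simp
    thus "a * \<kappa>\<^sub>0 \<le> m * b"
      using m by (simp add: divide_le_eq mult.commute)
  qed (simp add: b_def)
  \<comment> \<open>Truncating at \<open>v \<le> b\<close> and \<open>\<xi> \<le> b / a\<close> keeps \<open>d p + a q \<ge> m b\<close> for the truncated values \<open>p, q\<close>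
    as soon as \<open>v + a \<xi> > b\<close>, so the a priori bound also holds for the truncated system.\<close>
  obtain v \<xi> where C1: "C1_halfline v" "C1_halfline \<xi>" and init: "v 0 = v\<^sub>0" "\<xi> 0 = \<xi>\<^sub>0"
    and deriv: "\<And>t. 0 < t \<Longrightarrow>
      (v has_real_derivative u_rate a d (max 0 (min b (v t))) (max 0 (min (b / a) (\<xi> t)))) (at t)"
      "\<And>t. 0 < t \<Longrightarrow>
      (\<xi> has_real_derivative \<xi>_rate \<kappa>\<^sub>0 (max 0 (min b (v t))) (max 0 (min (b / a) (\<xi> t)))) (at t)"
    using truncated_ode_solution_exists[of a d b "b / a" v\<^sub>0 \<xi>\<^sub>0 \<kappa>\<^sub>0] pos b(1) by auto
  have cont: "continuous_on {0..} v" "continuous_on {0..} \<xi>"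
    using C1 by (auto intro: C1_halfline_imp_continuous_on)
  \<comment> \<open>Where \<open>v\<close> is negative its truncated value is 0, and there
    \<open>u_rate\<close> vanishes.\<close>
  have v_nonneg: "0 \<le> v t" if "0 \<le> t" for t
  proof -
    have "- v t \<le> 0"
    proof (rule le_barrier[where f = "\<lambda>t. - v t"])
      show "((\<lambda>t. - v t) has_real_derivative
          - u_rate a d (max 0 (min b (v t))) (max 0 (min (b / a) (\<xi> t)))) (at t)" if "0 < t" for t
        using deriv(1)[OF that] by (rule DERIV_minus)
      show "- u_rate a d (max 0 (min b (v t))) (max 0 (min (b / a) (\<xi> t))) \<le> 0" if "0 < - v t" for t
        using that by (simp add: u_rate_def max_def)
    qed (use that init assms in \<open>auto intro!: continuous_intros cont\<close>)
    thus ?thesis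
      by simp
  qed
  \<comment> \<open>Where \<xi> is negative its truncated value is 0, and there
    \<open>\<xi>_rate\<close> equals \<open>\<kappa>\<^sub>0 > 0\<close>.\<close>
  have \<xi>_nonneg: "0 \<le> \<xi> t" if "0 \<le> t" for t
  proof -
    have "- \<xi> t \<le> 0"
    proof (rule le_barrier[where f = "\<lambda>t. - \<xi> t"])
      show "((\<lambda>t. - \<xi> t) has_real_derivative
          - \<xi>_rate \<kappa>\<^sub>0 (max 0 (min b (v t))) (max 0 (min (b / a) (\<xi> t)))) (at t)" if "0 < t" for t
        using deriv(2)[OF that] by (rule DERIV_minus)
      show "- \<xi>_rate \<kappa>\<^sub>0 (max 0 (min b (v t))) (max 0 (min (b / a) (\<xi> t))) \<le> 0" if "0 < - \<xi> t" for t
      proof -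
        have "max 0 (min (b / a) (\<xi> t)) = 0"
          using that by simp
        thus ?thesis
          using pos by (simp add: \<xi>_rate_def)
      qed
    qed (use that init assms in \<open>auto intro!: continuous_intros cont\<close>)
    thus ?thesis
      by simp
  qed
  have mass: "v t + a * \<xi> t \<le> b" if "0 \<le> t" for t
  proof (rule le_barrier[where f = "\<lambda>t. v t + a * \<xi> t"])
    fix t :: real assume "0 < t"
    let ?p = "max 0 (min b (v t))" and ?q = "max 0 (min (b / a) (\<xi> t))"
    show "((\<lambda>t. v t + a * \<xi> t) has_real_derivative u_rate a d ?p ?q + a * \<xi>_rate \<kappa>\<^sub>0 ?p ?q) (at t)"
      using deriv[OF \<open>0 < t\<close>] by (auto intro!: derivative_eq_intros)
    assume large: "b < v t + a * \<xi> t"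
    have vx: "0 \<le> v t" "0 \<le> \<xi> t"
      using v_nonneg \<xi>_nonneg \<open>0 < t\<close> by auto
    have q: "a * ?q = min b (a * \<xi> t)"
      using vx pos b(1) by (auto simp: min_def max_def field_simps)
    \<comment> \<open>A coordinate cut off from above already contributes \<open>b\<close> alone; if
      neither is cut off, the sum is \<open>v t + a * \<xi> t\<close>.\<close>
    have "b \<le> ?p + a * ?q"
      unfolding q using vx large b(1) pos by (auto simp: min_def max_def)
    hence "m * b \<le> m * (?p + a * ?q)"
      using m by simp
    also have "\<dots> \<le> d * ?p + a * ?q"
    proof -
      have "m * ?p \<le> d * ?p" "m * (a * ?q) \<le> 1 * (a * ?q)"
        using m pos by (intro mult_right_mono; simp)+
      thus ?thesis
        by (simp add: distrib_left)
    qed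
    finally show "u_rate a d ?p ?q + a * \<xi>_rate \<kappa>\<^sub>0 ?p ?q \<le> 0"
      using mass_rate_le[of a ?p ?q d \<kappa>\<^sub>0] b(3) pos by linarith
  qed (use that init b in \<open>auto intro!: continuous_intros cont\<close>)
  have le: "v t \<le> b" "\<xi> t \<le> b / a" if "0 \<le> t" for t
  proof -
    have "0 \<le> a * \<xi> t"
      using \<xi>_nonneg[OF that] pos by simp
    thus "v t \<le> b"
      using mass[OF that] by linarith
    show "\<xi> t \<le> b / a"
      using mass[OF that] v_nonneg[OF that] pos by (simp add: le_divide_eq mult.commute)
  qed
  show thesis
  proof (rule that[of v \<xi> "max b (b / a)"])
    have "max 0 (min b (v t)) = v t" "max 0 (min (b / a) (\<xi> t)) = \<xi> t" if "0 < t" for t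
      using v_nonneg[of t] \<xi>_nonneg[of t] le[of t] that by auto
    thus "ode_solution a d \<kappa>\<^sub>0 v\<^sub>0 \<xi>\<^sub>0 v \<xi>"
      unfolding ode_solution_iff_rates using C1 init deriv by metis
  qed (use v_nonneg \<xi>_nonneg le in \<open>auto simp: le_max_iff_disj\<close>)
qed

text \<open>Dropping the nonnegative growth term gives \<open>v' \<ge> - d * v\<close>. Dropping
  \<open>\<kappa>\<^sub>0\<close> and using \<open>v \<le> b\<close> gives a linear lower bound for
  the derivative of \<xi> with the constant rate \<open>1 + b\<^sup>2\<close>.\<close>

lemma bounded_ode_solution_positive:
  assumes sol: "ode_solution a d \<kappa>\<^sub>0 v\<^sub>0 \<xi>\<^sub>0 v \<xi>"
    and bound: "\<And>t. 0 \<le> t \<Longrightarrow> 0 \<le> v t \<and> v t \<le> b \<and> 0 \<le> \<xi> t"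
    and pos: "0 < a" "0 < \<kappa>\<^sub>0" "0 < v\<^sub>0" "0 < \<xi>\<^sub>0"
  shows "positive_ode_solution a d \<kappa>\<^sub>0 v\<^sub>0 \<xi>\<^sub>0 v \<xi>"
proof -
  note sol' = sol[unfolded ode_solution_iff_rates]
  have "0 < v t" if "0 \<le> t" for t
  proof (rule positive_if_deriv_ge_linear[where f = v and C = d])
    show "- d * v t \<le> u_rate a d (v t) (\<xi> t)" if "0 < t" for t
    proof -
      have "0 \<le> a * v t * \<xi> t / (1 + v t * \<xi> t) * v t"
        using bound[of t] that pos by auto
      thus ?thesis
        by (simp add: u_rate_def left_diff_distrib)
    qed
  qed (use sol' pos that in \<open>auto intro: C1_halfline_imp_continuous_on\<close>)
  moreover have "0 < \<xi> t" if "0 \<le> t" for t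
  proof (rule positive_if_deriv_ge_linear[where f = \<xi> and C = "1 + b\<^sup>2"])
    show "- (1 + b\<^sup>2) * \<xi> t \<le> \<xi>_rate \<kappa>\<^sub>0 (v t) (\<xi> t)" if "0 < t" for t
    proof -
      have "\<xi> t * (v t)\<^sup>2 \<le> \<xi> t * b\<^sup>2"
        using bound[of t] that by (intro mult_left_mono power_mono) auto
      thus ?thesis
        using pos by (simp add: \<xi>_rate_def algebra_simps)
    qed
  qed (use sol' pos that in \<open>auto intro: C1_halfline_imp_continuous_on\<close>)
  ultimately show ?thesis
    using sol by (auto simp: positive_ode_solution_def)
qed

subsection \<open>Uniqueness\<close>

lemma continuous_halfline_bounded_above:
  fixes f :: "real \<Rightarrow> real"
  assumes "continuous_on {0..} f"
  obtains B where "\<And>t. t \<in> {0..T} \<Longrightarrow> f t \<le> B"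
proof -
  have "compact (f ` {0..T})"
    using assms by (intro compact_continuous_image) (auto intro: continuous_on_subset)
  hence "bdd_above (f ` {0..T})"
    by (intro bounded_imp_bdd_above compact_imp_bounded)
  then obtain B where "\<forall>t\<in>{0..T}. f t \<le> B"
    by (auto simp: bdd_above_def)
  thus thesis
    using that by blast
qed

text \<open>Local Lipschitz continuity suffices: on \<open>{0..T}\<close> continuity confines both
  solutions to a square of side \<open>R\<close>, which may depend on \<open>T\<close>, and the
  Gronwall estimate applies to their differences.\<close>

lemma ode_solution_unique:
  assumes sol: "ode_solution a d \<kappa>\<^sub>0 v\<^sub>0 \<xi>\<^sub>0 v \<xi>" "ode_solution a d \<kappa>\<^sub>0 v\<^sub>0 \<xi>\<^sub>0 v' \<xi>'"
    and nonneg: "\<And>t. 0 \<le> t \<Longrightarrow> 0 \<le> v t \<and> 0 \<le> \<xi> t" "\<And>t. 0 \<le> t \<Longrightarrow> 0 \<le> v' t \<and> 0 \<le> \<xi>' t"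
    and pos: "0 < a" "0 < d" and "0 \<le> T"
  shows "v T = v' T \<and> \<xi> T = \<xi>' T"
proof -
  note sol' = sol[unfolded ode_solution_iff_rates]
  have cont: "continuous_on {0..} v" "continuous_on {0..} \<xi>"
      "continuous_on {0..} v'" "continuous_on {0..} \<xi>'"
    using sol' by (auto intro: C1_halfline_imp_continuous_on)
  have "continuous_on {0..} (\<lambda>t. max (max (v t) (\<xi> t)) (max (v' t) (\<xi>' t)))"
    by (intro continuous_intros cont)
  then obtain R where R: "\<And>t. t \<in> {0..T} \<Longrightarrow> max (max (v t) (\<xi> t)) (max (v' t) (\<xi>' t)) \<le> R"
    using continuous_halfline_bounded_above[where T = T] by blast
  obtain L where L: "0 \<le> L"
    "\<And>p q p' q'. p \<in> {0..R} \<Longrightarrow> q \<in> {0..R} \<Longrightarrow> p' \<in> {0..R} \<Longrightarrow> q' \<in> {0..R} \<Longrightarrow>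
      \<bar>u_rate a d p q - u_rate a d p' q'\<bar> \<le> L * (\<bar>p - p'\<bar> + \<bar>q - q'\<bar>) \<and>
      \<bar>\<xi>_rate \<kappa>\<^sub>0 p q - \<xi>_rate \<kappa>\<^sub>0 p' q'\<bar> \<le> L * (\<bar>p - p'\<bar> + \<bar>q - q'\<bar>)"
    using rates_Lipschitz[OF pos] by metis
  have in_R: "v t \<in> {0..R}" "\<xi> t \<in> {0..R}" "v' t \<in> {0..R}" "\<xi>' t \<in> {0..R}" if "0 < t" "t < T" for t
    using R[of t] nonneg[of t] that by auto
  have "v T - v' T = 0 \<and> \<xi> T - \<xi>' T = 0"
  proof (rule Gronwall_pair_zero[where e\<^sub>1 = "\<lambda>t. v t - v' t" and e\<^sub>2 = "\<lambda>t. \<xi> t - \<xi>' t" and L = L])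
    fix t assume t: "0 < t" "t < T"
    show "((\<lambda>t. v t - v' t) has_real_derivative u_rate a d (v t) (\<xi> t) - u_rate a d (v' t) (\<xi>' t)) (at t)"
      "((\<lambda>t. \<xi> t - \<xi>' t) has_real_derivative \<xi>_rate \<kappa>\<^sub>0 (v t) (\<xi> t) - \<xi>_rate \<kappa>\<^sub>0 (v' t) (\<xi>' t)) (at t)"
      using sol' t by (auto intro!: DERIV_diff)
    show "\<bar>u_rate a d (v t) (\<xi> t) - u_rate a d (v' t) (\<xi>' t)\<bar> \<le> L * (\<bar>v t - v' t\<bar> + \<bar>\<xi> t - \<xi>' t\<bar>)"
      "\<bar>\<xi>_rate \<kappa>\<^sub>0 (v t) (\<xi> t) - \<xi>_rate \<kappa>\<^sub>0 (v' t) (\<xi>' t)\<bar> \<le> L * (\<bar>v t - v' t\<bar> + \<bar>\<xi> t - \<xi>' t\<bar>)"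
      using L(2)[OF in_R[OF t]] by auto
  next
    show "continuous_on {0..T} (\<lambda>t. v t - v' t)" "continuous_on {0..T} (\<lambda>t. \<xi> t - \<xi>' t)"
      by (intro continuous_intros continuous_on_subset[OF cont(1)] continuous_on_subset[OF cont(2)]
          continuous_on_subset[OF cont(3)] continuous_on_subset[OF cont(4)]; auto)+
  qed (use sol' L \<open>0 \<le> T\<close> in auto)
  thus ?thesis
    by simp
qed

text \<open>Here \<xi> is a prescribed coefficient. This is the situation of \<open>u\<close> at two
  points of the domain, which share the same \<xi>.\<close>

lemma scalar_solution_unique:
  assumes cont: "continuous_on {0..} v" "continuous_on {0..} v'" "continuous_on {0..} \<xi>"
    and deriv: "\<And>t. 0 < t \<Longrightarrow> (v has_real_derivative u_rate a d (v t) (\<xi> t)) (at t)"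
      "\<And>t. 0 < t \<Longrightarrow> (v' has_real_derivative u_rate a d (v' t) (\<xi> t)) (at t)"
    and nonneg: "\<And>t. 0 \<le> t \<Longrightarrow> 0 \<le> v t \<and> 0 \<le> v' t \<and> 0 \<le> \<xi> t"
    and "v 0 = v' 0" and pos: "0 < a" "0 < d" and "0 \<le> T"
  shows "v T = v' T"
proof -
  have "continuous_on {0..} (\<lambda>t. max (max (v t) (v' t)) (\<xi> t))"
    by (intro continuous_intros cont)
  then obtain R where R: "\<And>t. t \<in> {0..T} \<Longrightarrow> max (max (v t) (v' t)) (\<xi> t) \<le> R"
    using continuous_halfline_bounded_above[where T = T] by blast
  define L where "L = a * (2 * R\<^sup>2 + R ^ 4) + d"
  hence "0 \<le> L"
    using pos by simp
  \<comment> \<open>The pair version of Gronwall is reused with a vanishing second component, hence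
    the trivial conjunct.\<close>
  have "v T - v' T = 0 \<and> (0::real) = 0"
  proof (rule Gronwall_pair_zero[where e\<^sub>1 = "\<lambda>t. v t - v' t" and e\<^sub>2 = "\<lambda>t. 0" and L = L])
    fix t assume t: "0 < t" "t < T"
    show "((\<lambda>t. v t - v' t) has_real_derivative u_rate a d (v t) (\<xi> t) - u_rate a d (v' t) (\<xi> t)) (at t)"
      using deriv[OF t(1)] by (rule DERIV_diff)
    have "v t \<in> {0..R}" "v' t \<in> {0..R}" "\<xi> t \<in> {0..R}"
      using R[of t] nonneg[of t] t by auto
    thus "\<bar>u_rate a d (v t) (\<xi> t) - u_rate a d (v' t) (\<xi> t)\<bar> \<le> L * (\<bar>v t - v' t\<bar> + \<bar>0\<bar>)"
      using u_rate_Lipschitz[of "v t" R "\<xi> t" "v' t" "\<xi> t" a d] pos by (simp add: L_def)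
    show "((\<lambda>t. 0) has_real_derivative 0) (at t)"
      by simp
    show "\<bar>0\<bar> \<le> L * (\<bar>v t - v' t\<bar> + \<bar>0\<bar>)"
      using \<open>0 \<le> L\<close> by simp
  next
    show "continuous_on {0..T} (\<lambda>t. v t - v' t)"
      by (intro continuous_intros continuous_on_subset[OF cont(1)] continuous_on_subset[OF cont(2)]) auto
  qed (use assms \<open>0 \<le> L\<close> in auto)
  thus ?thesis
    by simp
qed

subsection \<open>The nonlocal problem\<close>

text \<open>This is how the unit measure of the domain turns the nonlocal term into the local
  \<open>v\<^sup>2\<close>.\<close>

lemma set_lebesgue_integral_const_probability:
  fixes c :: real
  assumes "\<Omega> \<in> sets lebesgue" and "measure lebesgue \<Omega> = 1"
  shows "(LINT x:\<Omega>|lebesgue. c) = c"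
  using assms by (simp add: set_lebesgue_integral_def measure_def)

text \<open>This yields existence for the nonlocal problem. For a function constant in space,
  uniform convergence in time is just continuity of \<open>v\<close>.\<close>

lemma ode_solution_imp_nonlocal_solution:
  assumes sol: "ode_solution a d \<kappa>\<^sub>0 v\<^sub>0 \<xi>\<^sub>0 v \<xi>"
    and nonneg: "\<And>t. 0 \<le> t \<Longrightarrow> 0 \<le> v t \<and> 0 \<le> \<xi> t"
    and \<Omega>: "\<Omega> \<in> sets lebesgue" "measure lebesgue \<Omega> = 1"
    and "\<forall>x\<in>\<Omega>. u\<^sub>0 x = v\<^sub>0"
  shows "nonlocal_solution \<Omega> a d \<kappa>\<^sub>0 u\<^sub>0 \<xi>\<^sub>0 (\<lambda>t x. v t) \<xi>"
proof -
  have "continuous_on {0..} v"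
    using sol by (auto simp: ode_solution_def intro: C1_halfline_imp_continuous_on)
  hence "C_halfline_into_C (closure \<Omega>) (\<lambda>t x. v t)"
    by (auto simp: C_halfline_into_C_def continuous_on_def uniform_limit_iff tendsto_iff elim: eventually_mono)
  thus ?thesis
    using assms set_lebesgue_integral_const_probability[OF \<Omega>]
    by (auto simp: nonlocal_solution_def ode_solution_def)
qed

text \<open>The integral enters only the equation for \<xi>. Once \<xi> is fixed, the equations at
  different points decouple and coincide, so equal initial values give equal solutions. No
  uniqueness result for the nonlocal problem itself is invoked.\<close>

lemma nonlocal_solution_constant_in_space:
  assumes sol: "nonlocal_solution \<Omega> a d \<kappa>\<^sub>0 u\<^sub>0 \<xi>\<^sub>0 u \<xi>"
    and \<Omega>: "\<Omega> \<in> sets lebesgue" "measure lebesgue \<Omega> = 1"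
    and const: "\<forall>x\<in>\<Omega>. u\<^sub>0 x = v\<^sub>0" and pos: "0 < a" "0 < d"
  obtains v where "\<forall>t\<ge>0. \<forall>x\<in>closure \<Omega>. u t x = v t" "ode_solution a d \<kappa>\<^sub>0 v\<^sub>0 \<xi>\<^sub>0 v \<xi>"
proof -
  \<comment> \<open>A set of measure 1 contains a point \<open>y\<close>; the required
    \<open>v\<close> will be \<open>u\<close> at \<open>y\<close>.\<close>
  have "\<Omega> \<noteq> {}"
    using \<Omega> by auto
  then obtain y where y: "y \<in> \<Omega>"
    by blast
  have nonneg: "0 \<le> u t x" "0 \<le> \<xi> t" if "0 \<le> t" "x \<in> \<Omega>" for t x
    using sol that closure_subset[of \<Omega>] by (auto simp: nonlocal_solution_def)
  have C1: "C1_halfline \<xi>" "\<And>x. x \<in> \<Omega> \<Longrightarrow> C1_halfline (\<lambda>t. u t x)"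
    using sol by (auto simp: nonlocal_solution_def)
  have deriv: "((\<lambda>t. u t x) has_real_derivative u_rate a d (u t x) (\<xi> t)) (at t)"
    if "x \<in> \<Omega>" "0 < t" for x t
    using sol that by (auto simp: nonlocal_solution_def u_rate_def)
  have init: "u 0 x = v\<^sub>0" if "x \<in> \<Omega>" for x
    using sol const that by (auto simp: nonlocal_solution_def)
  have on_\<Omega>: "u t x = u t y" if "0 \<le> t" "x \<in> \<Omega>" for t x
  proof (rule scalar_solution_unique[where v = "\<lambda>t. u t x" and v' = "\<lambda>t. u t y" and \<xi> = \<xi>])
    show "continuous_on {0..} (\<lambda>t. u t x)" "continuous_on {0..} (\<lambda>t. u t y)" "continuous_on {0..} \<xi>"
      using C1 that y by (auto intro: C1_halfline_imp_continuous_on)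
    show "((\<lambda>t. u t x) has_real_derivative u_rate a d (u s x) (\<xi> s)) (at s)"
      "((\<lambda>t. u t y) has_real_derivative u_rate a d (u s y) (\<xi> s)) (at s)" if "0 < s" for s
      using deriv \<open>x \<in> \<Omega>\<close> y that by blast+
  qed (use that y init nonneg pos in auto)
  \<comment> \<open>The differential equation is imposed only on the set itself; continuity in space
    carries constancy to the remaining points of the closure.\<close>
  have on_closure: "\<forall>t\<ge>0. \<forall>x\<in>closure \<Omega>. u t x = u t y"
  proof (intro allI impI ballI)
    fix t :: real and x assume t: "0 \<le> t" and x: "x \<in> closure \<Omega>"
    have "continuous_on (closure \<Omega>) (u t)"
      using sol t by (auto simp: nonlocal_solution_def C_halfline_into_C_def)
    thus "u t x = u t y"
      using on_\<Omega>[OF t] x by (rule continuous_constant_on_closure)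
  qed
  have int: "(LINT x:\<Omega>|lebesgue. (u t x)\<^sup>2) = (u t y)\<^sup>2" if "0 < t" for t
  proof -
    have "(LINT x:\<Omega>|lebesgue. (u t x)\<^sup>2) = (LINT x:\<Omega>|lebesgue. (u t y)\<^sup>2)"
      using on_\<Omega>[of t] that \<Omega>(1) by (intro set_lebesgue_integral_cong) auto
    thus ?thesis
      by (simp add: set_lebesgue_integral_const_probability[OF \<Omega>])
  qed
  have "ode_solution a d \<kappa>\<^sub>0 v\<^sub>0 \<xi>\<^sub>0 (\<lambda>t. u t y) \<xi>"
    using sol y init[OF y] int by (auto simp: nonlocal_solution_def ode_solution_def)
  with on_closure show thesis
    by (rule that)
qed

theorem proposition2p2:
  fixes \<Omega> :: "(real ^ 'n) set"
    and a d \<kappa>\<^sub>0 \<xi>\<^sub>0 ubar\<^sub>0 :: real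
    and u\<^sub>0 :: "real ^ 'n \<Rightarrow> real"
  assumes "bounded \<Omega>" and "\<Omega> \<in> sets lebesgue" and "measure lebesgue \<Omega> = 1"
    and "a > 0" and "d > 0" and "\<kappa>\<^sub>0 > 0"
    and "\<forall>x\<in>\<Omega>. u\<^sub>0 x \<ge> 0" and "\<xi>\<^sub>0 > 0"
    and "\<forall>x\<in>\<Omega>. u\<^sub>0 x = ubar\<^sub>0"
  shows "(\<exists>u \<xi>. nonlocal_solution \<Omega> a d \<kappa>\<^sub>0 u\<^sub>0 \<xi>\<^sub>0 u \<xi>) \<and>
    (\<forall>u \<xi>. nonlocal_solution \<Omega> a d \<kappa>\<^sub>0 u\<^sub>0 \<xi>\<^sub>0 u \<xi> \<longrightarrow>
       (\<exists>v. (\<forall>t\<ge>0. \<forall>x\<in>closure \<Omega>. u t x = v t) \<and>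
            ode_solution a d \<kappa>\<^sub>0 ubar\<^sub>0 \<xi>\<^sub>0 v \<xi>)) \<and>
    (ubar\<^sub>0 > 0 \<longrightarrow>
       (\<exists>v \<xi>. positive_ode_solution a d \<kappa>\<^sub>0 ubar\<^sub>0 \<xi>\<^sub>0 v \<xi> \<and>
          (\<forall>v' \<xi>'. positive_ode_solution a d \<kappa>\<^sub>0 ubar\<^sub>0 \<xi>\<^sub>0 v' \<xi>' \<longrightarrow>
             (\<forall>t\<ge>0. v' t = v t \<and> \<xi>' t = \<xi> t)) \<and>
          bounded ((\<lambda>t. (v t, \<xi> t)) ` {0<..})))"
proof -
  \<comment> \<open>A point of the domain is needed to transfer \<open>u\<^sub>0 x \<ge> 0\<close>
    to the constant \<open>ubar\<^sub>0\<close>.\<close>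
  have "\<Omega> \<noteq> {}"
    using assms(3) by auto
  hence "0 \<le> ubar\<^sub>0"
    using assms(7,9) by auto
  \<comment> \<open>This one bounded solution serves throughout: it solves the nonlocal problem, is
    positive when \<open>ubar\<^sub>0 > 0\<close>, and is the one with which any other positive
    solution is compared.\<close>
  then obtain v \<xi> b where sol: "ode_solution a d \<kappa>\<^sub>0 ubar\<^sub>0 \<xi>\<^sub>0 v \<xi>"
    and bound: "\<And>t. 0 \<le> t \<Longrightarrow> 0 \<le> v t \<and> v t \<le> b \<and> 0 \<le> \<xi> t \<and> \<xi> t \<le> b"
    using bounded_ode_solution_exists[of a d \<kappa>\<^sub>0 ubar\<^sub>0 \<xi>\<^sub>0] assms by metis
  have "nonlocal_solution \<Omega> a d \<kappa>\<^sub>0 u\<^sub>0 \<xi>\<^sub>0 (\<lambda>t x. v t) \<xi>"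
    using sol bound assms by (intro ode_solution_imp_nonlocal_solution) auto
  moreover have "\<exists>v. (\<forall>t\<ge>0. \<forall>x\<in>closure \<Omega>. u t x = v t) \<and> ode_solution a d \<kappa>\<^sub>0 ubar\<^sub>0 \<xi>\<^sub>0 v \<xi>"
    if "nonlocal_solution \<Omega> a d \<kappa>\<^sub>0 u\<^sub>0 \<xi>\<^sub>0 u \<xi>" for u \<xi>
    using nonlocal_solution_constant_in_space[OF that assms(2,3,9,4,5)] by metis
  moreover have "positive_ode_solution a d \<kappa>\<^sub>0 ubar\<^sub>0 \<xi>\<^sub>0 v \<xi>" if "0 < ubar\<^sub>0"
    using bounded_ode_solution_positive[OF sol, of b] bound assms that by blast
  moreover have "v' t = v t \<and> \<xi>' t = \<xi> t"
    if "positive_ode_solution a d \<kappa>\<^sub>0 ubar\<^sub>0 \<xi>\<^sub>0 v' \<xi>'" "0 \<le> t" for v' \<xi>' t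
  proof (rule ode_solution_unique[OF _ sol])
    show "ode_solution a d \<kappa>\<^sub>0 ubar\<^sub>0 \<xi>\<^sub>0 v' \<xi>'"
      using that by (simp add: positive_ode_solution_def)
    show "0 \<le> v' s \<and> 0 \<le> \<xi>' s" if "0 \<le> s" for s
      using \<open>positive_ode_solution a d \<kappa>\<^sub>0 ubar\<^sub>0 \<xi>\<^sub>0 v' \<xi>'\<close> that
      by (simp add: positive_ode_solution_def less_imp_le)
  qed (use bound assms that in auto)
  moreover have "bounded ((\<lambda>t. (v t, \<xi> t)) ` {0<..})"
  proof (rule bounded_subset)
    show "bounded (cbox (0, 0) (b, b))"
      by (rule bounded_cbox)
    show "(\<lambda>t. (v t, \<xi> t)) ` {0<..} \<subseteq> cbox (0, 0) (b, b)"
      using bound by (force simp: cbox_Pair_eq)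
  qed
  ultimately show ?thesis
    by blast
qed

end
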